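(* Let $n\ge4$ and $2\le k\le n-2$ be integers, and let $m=\binom n2$. Let $\partial:\mathbb{F}_2^m\to\mathbb{F}_2^n$ be the degree-parity map $\partial(F)_v=\deg_F(v)\pmod 2$ for $v\in[n]$, and let $e:\mathbb{F}_2^m\to\mathbb{F}_2$ be the edge-count parity $e(F)=|F|\pmod 2$. Let $H_k$ be the subgroup of $\mathbb{F}_2^m$ generated by the vectors $v_X$ with $X\subseteq[n]$, $|X|=k$. Then $$H_k=\begin{cases}\mathbb{F}_2^m,& k\equiv2\pmod4,\\ \ker(e),& k\equiv0\pmod4,\\ \ker(\partial),& k\equiv3\pmod4,\\ \ker(\partial)\cap\ker(e),& k\equiv1\pmod4.\end{cases}$$
   Context: Coordinates of $\mathbb{F}_2^m$, $m=\binom n2$, are indexed by the unordered pairs $\{i,j\}\subseteq[n]=\{1,\dots,n\}$, $i\ne j$. A vector in $\mathbb{F}_2^m$ is identified with its support, a set $F$ of edges of the complete graph on $[n]$ (addition is symmetric difference); $\deg_F(v)$ is the number of edges of $F$ containing $v$, and $|F|$ is the number of edges of $F$. For $X\subseteq[n]$, $v_X\in\mathbb{F}_2^m$ is the indicator vector of the clique on $X$: $(v_X)_{\{i,j\}}=1$ if $\{i,j\}\subseteq X$ and $0$ otherwise. (The $k$-restricted inversion walk on labelled tournaments on $[n]$ reverses, at each step, all arcs inside a uniformly random $k$-subset $X$. Encoding a tournament by the vector recording on which pairs it disagrees with a fixed reference tournament, a step adds $v_X$, so the states reachable from a given one form a coset of $H_k$.) *)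

theory Defs
  imports "HOL-Algebra.Product_Groups"
begin

text \<open>
  The additive group of $F_2$ is \<^term>\<open>integer_mod_group 2\<close> (carrier \<^term>\<open>{0, 1 :: int}\<close>, addition
  modulo 2), and $F_2^I$ is its \<^const>\<open>product_group\<close> over \<^term>\<open>I\<close>: the functions on \<^term>\<open>I\<close>,
  extensional outside \<^term>\<open>I\<close>, with componentwise addition.
\<close>

abbreviation F2 :: "int monoid" where
  "F2 \<equiv> integer_mod_group 2"

abbreviation F2_power :: "'a set \<Rightarrow> ('a \<Rightarrow> int) monoid" where
  "F2_power I \<equiv> product_group I (\<lambda>_. F2)"

definition edges :: "nat \<Rightarrow> nat set set" where
  "edges n = {{i, j} | i j. i \<in> {1..n} \<and> j \<in> {1..n} \<and> i \<noteq> j}"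

lemma card_edges: "card (edges n) = n choose 2"
proof -
  have "edges n = {e. e \<subseteq> {1..n} \<and> card e = 2}"
    unfolding edges_def card_2_iff by blast
  then show ?thesis
    by (simp add: n_subsets)
qed

abbreviation edge_space :: "nat \<Rightarrow> (nat set \<Rightarrow> int) monoid" where
  "edge_space n \<equiv> F2_power (edges n)"

definition support :: "nat \<Rightarrow> (nat set \<Rightarrow> int) \<Rightarrow> nat set set" where
  "support n f = {e \<in> edges n. f e = 1}"

definition deg :: "nat set set \<Rightarrow> nat \<Rightarrow> nat" where
  "deg F v = card {e \<in> F. v \<in> e}"

definition degree_parity :: "nat \<Rightarrow> (nat set \<Rightarrow> int) \<Rightarrow> nat \<Rightarrow> int" where
  "degree_parity n f = (\<lambda>v\<in>{1..n}. int (deg (support n f) v) mod 2)"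

definition edge_parity :: "nat \<Rightarrow> (nat set \<Rightarrow> int) \<Rightarrow> int" where
  "edge_parity n f = int (card (support n f)) mod 2"

definition clique_vector :: "nat \<Rightarrow> nat set \<Rightarrow> nat set \<Rightarrow> int" where
  "clique_vector n X = (\<lambda>e\<in>edges n. if e \<subseteq> X then 1 else 0)"

definition clique_subgroup :: "nat \<Rightarrow> nat \<Rightarrow> (nat set \<Rightarrow> int) set" where
  "clique_subgroup n k =
     generate (edge_space n) {clique_vector n X | X. X \<subseteq> {1..n} \<and> card X = k}"

lemma clique_vector_carrier: "clique_vector n X \<in> carrier (edge_space n)"
  by (auto simp: clique_vector_def carrier_integer_mod_group)

lemma degree_parity_carrier: "degree_parity n f \<in> carrier (F2_power {1..n})"
  by (auto simp: degree_parity_def carrier_integer_mod_group)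

lemma edge_parity_carrier: "edge_parity n f \<in> carrier F2"
  by (auto simp: edge_parity_def carrier_integer_mod_group)

end

theory Submission
  imports Defs
begin

text \<open>
  Summing the cliques on \<open>Z \<union> {s, t}\<close> for \<open>s \<in> {a, b}\<close> and \<open>t \<in> {c, d}\<close>, where \<open>Z\<close> has \<open>k - 2\<close>
  elements, leaves the 4-cycle \<open>a c b d\<close>; this is where \<open>k \<le> n - 2\<close> enters. Modulo 4-cycles all
  triangles through a fixed vertex are equal, and the even graphs are generated by such triangles, so
  the 4-cycles generate \<open>ker \<partial> \<inter> ker e\<close>. A clique on \<open>k\<close> points has \<open>k choose 2\<close> edges and all its
  degrees are \<open>k - 1\<close>. For odd \<open>k\<close> it only remains to look at the parity of \<open>k choose 2\<close>. For even
  \<open>k\<close>, the sum of the cliques on \<open>Y \<union> {a}\<close> and \<open>Y \<union> {b}\<close> has an even number of edges and odd degree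
  exactly at \<open>a\<close> and \<open>b\<close>; by the handshake lemma these sums reduce every \<open>F\<close> with \<open>e(F) = 0\<close> to an
  even graph.
\<close>

section \<open>Parities of symmetric differences and of \<open>k choose 2\<close>\<close>

lemma even_card_sym_diff:
  assumes "finite A" "finite B"
  shows "even (card (sym_diff A B)) \<longleftrightarrow> (even (card A) \<longleftrightarrow> even (card B))"
proof -
  have "card (sym_diff A B) = card (A - B) + card (B - A)"
    using assms by (intro card_Un_disjoint) auto
  moreover have "card A = card (A - B) + card (A \<inter> B)" "card B = card (B - A) + card (A \<inter> B)"
    using assms by (metis add.commute card_Int_Diff inf_commute)+
  ultimately show ?thesis by auto
qed

lemma even_choose_two: "even (k choose 2) \<longleftrightarrow> k mod 4 = 0 \<or> k mod 4 = 1"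
proof (induction k)
  case (Suc k)
  have "Suc k choose 2 = k + (k choose 2)"
    by (simp add: numeral_2_eq_2)
  then show ?case using Suc by presburger
qed (simp add: binomial_eq_0)

section \<open>Graphs as edge sets: cliques, odd degrees, the handshake lemma\<close>

lemma edges_eq: "edges n = {e. e \<subseteq> {1..n} \<and> card e = 2}"
  unfolding edges_def card_2_iff by blast

lemma finite_edges [simp]: "finite (edges n)"
  by (simp add: edges_eq)

text \<open>The support of \<open>clique_vector n X\<close>. The combinatorics is carried out on
  edge sets, where addition is \<open>sym_diff\<close>; vectors return only through
  \<open>support\<close>.\<close>

definition clique :: "nat \<Rightarrow> nat set \<Rightarrow> nat set set" where
  "clique n X = {e \<in> edges n. e \<subseteq> X}"

text \<open>The support of the degree-parity vector, so that membership in its kernel becomes an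
  equation with the empty set.\<close>

definition odd_vertices :: "nat \<Rightarrow> nat set set \<Rightarrow> nat set" where
  "odd_vertices n F = {v \<in> {1..n}. odd (deg F v)}"

definition four_cycle :: "nat \<Rightarrow> nat \<Rightarrow> nat \<Rightarrow> nat \<Rightarrow> nat set set" where
  "four_cycle a b c d = {{a, b}, {b, c}, {c, d}, {d, a}}"

lemma clique_subset_edges: "clique n X \<subseteq> edges n"
  by (auto simp: clique_def)

lemma finite_clique [simp]: "finite (clique n X)"
  using clique_subset_edges finite_edges by (rule finite_subset)

lemma card_clique:
  assumes "X \<subseteq> {1..n}"
  shows "card (clique n X) = card X choose 2"
proof -
  have "clique n X = {e. e \<subseteq> X \<and> card e = 2}"
    using assms by (auto simp: clique_def edges_eq)
  then show ?thesis
    using assms finite_subset[OF assms] by (simp add: n_subsets)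
qed

lemma deg_clique:
  assumes "X \<subseteq> {1..n}"
  shows "deg (clique n X) v = (if v \<in> X then card X - 1 else 0)"
proof (cases "v \<in> X")
  case True
  have fin: "finite X" using assms finite_subset by blast
  \<comment> \<open>The degree is read off as a difference of two edge counts,
    \<open>k choose 2\<close> minus \<open>(k - 1) choose 2\<close> for
    \<open>k = card X\<close>.\<close>
  have "{e \<in> clique n X. v \<in> e} = clique n X - clique n (X - {v})"
    by (auto simp: clique_def)
  moreover have "clique n (X - {v}) \<subseteq> clique n X"
    by (auto simp: clique_def)
  ultimately have "deg (clique n X) v = (card X choose 2) - (card (X - {v}) choose 2)"
    using assms card_clique[of X n] card_clique[of "X - {v}" n]
    by (simp add: deg_def card_Diff_subset subset_insertI2 Diff_subset[THEN subset_trans])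
  moreover obtain j where "card X = Suc j"
    using True fin by (metis card_Suc_Diff1)
  ultimately show ?thesis
    using True fin by (simp add: numeral_2_eq_2)
next
  case False
  then have "{e \<in> clique n X. v \<in> e} = {}" by (auto simp: clique_def)
  then show ?thesis using False by (simp only: deg_def card.empty if_False)
qed

lemma odd_vertices_clique:
  assumes "X \<subseteq> {1..n}"
  shows "odd_vertices n (clique n X) = (if even (card X) then X else {})"
proof -
  \<comment> \<open>Positivity guards the natural-number subtraction in \<open>card X - 1\<close>,
    whose parity is opposite to that of \<open>card X\<close> only for nonempty
    \<open>X\<close>.\<close>
  have "v \<in> X \<Longrightarrow> card X > 0" for v
    using assms finite_subset by (auto simp: card_gt_0_iff)
  then show ?thesis
    using assms by (auto simp: odd_vertices_def deg_clique)
qed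

text \<open>Linearity of the degree-parity map: selecting the edges through a fixed vertex commutes
  with \<open>sym_diff\<close>.\<close>

lemma odd_vertices_sym_diff:
  assumes "finite F" "finite G"
  shows "odd_vertices n (sym_diff F G) = sym_diff (odd_vertices n F) (odd_vertices n G)"
proof -
  have "{e \<in> sym_diff F G. v \<in> e} = sym_diff {e \<in> F. v \<in> e} {e \<in> G. v \<in> e}" for v
    by auto
  then have "even (deg (sym_diff F G) v) \<longleftrightarrow> (even (deg F v) \<longleftrightarrow> even (deg G v))" for v
    using assms unfolding deg_def by (simp add: even_card_sym_diff)
  then show ?thesis by (auto simp: odd_vertices_def)
qed

lemma odd_vertices_empty [simp]: "odd_vertices n {} = {}"
  by (auto simp: odd_vertices_def deg_def)

lemma finite_odd_vertices [simp]: "finite (odd_vertices n F)"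
  by (auto simp: odd_vertices_def)

text \<open>Edges are added one at a time: each new edge changes the set of odd vertices by its own
  two endpoints, which keeps the cardinality even.\<close>

lemma handshake:
  assumes "F \<subseteq> edges n"
  shows "even (card (odd_vertices n F))"
proof -
  have "finite F" using assms finite_edges by (rule finite_subset)
  then show ?thesis using assms
  proof (induction F rule: finite_induct)
    case (insert e F)
    have e: "e \<subseteq> {1..n}" "card e = 2" using insert.prems by (auto simp: edges_eq)
    have "{f \<in> {e}. v \<in> f} = (if v \<in> e then {e} else {})" for v by auto
    then have "odd_vertices n {e} = e"
      using e by (auto simp: odd_vertices_def deg_def)
    moreover have "insert e F = sym_diff {e} F" using insert.hyps by auto
    ultimately have "odd_vertices n (insert e F) = sym_diff e (odd_vertices n F)"
      using insert.hyps odd_vertices_sym_diff[of "{e}" F n] by simp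
    moreover have "finite e" using e(1) finite_subset by blast
    ultimately show ?case
      using insert e by (simp add: even_card_sym_diff)
  qed simp
qed

section \<open>4-cycles as sums of cliques and of triangles\<close>

lemma edge_eq_doubleton:
  assumes "e \<in> edges n" "s \<in> e" "t \<in> e" "s \<noteq> t"
  shows "e = {s, t}"
  using assms by (auto simp: edges_def)

text \<open>Inside \<open>Z \<union> {a, b, c, d}\<close>, an edge lies in one of the cliques iff it
  avoids the two vertices left out. Modulo 2 the four indicators sum to the product
  \<open>([a \<notin> e] + [b \<notin> e]) ([c \<notin> e] + [d \<notin> e])\<close>, so exactly one
  of \<open>a\<close>, \<open>b\<close> and exactly one of \<open>c\<close>, \<open>d\<close> lie on
  \<open>e\<close>. Hence \<open>a\<close> and \<open>b\<close> are opposite in the cycle.\<close>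

lemma clique_sum_four_cycle:
  assumes "{a, b, c, d} \<subseteq> {1..n}" "distinct [a, b, c, d]" "Z \<inter> {a, b, c, d} = {}"
  shows "sym_diff (sym_diff (clique n (Z \<union> {a, c})) (clique n (Z \<union> {b, c})))
           (sym_diff (clique n (Z \<union> {a, d})) (clique n (Z \<union> {b, d}))) = four_cycle a c b d"
    (is "?L = ?R")
proof -
  let ?Q = "\<lambda>e. e \<subseteq> Z \<union> {a, b, c, d}"
  have sub: "e \<subseteq> Z \<union> {a, c} \<longleftrightarrow> ?Q e \<and> b \<notin> e \<and> d \<notin> e" "e \<subseteq> Z \<union> {b, c} \<longleftrightarrow> ?Q e \<and> a \<notin> e \<and> d \<notin> e"
    "e \<subseteq> Z \<union> {a, d} \<longleftrightarrow> ?Q e \<and> b \<notin> e \<and> c \<notin> e" "e \<subseteq> Z \<union> {b, d} \<longleftrightarrow> ?Q e \<and> a \<notin> e \<and> c \<notin> e" for e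
    using assms(2,3) by auto
  have "e \<in> ?L \<longleftrightarrow> e \<in> edges n \<and> ?Q e \<and> (a \<in> e \<longleftrightarrow> b \<notin> e) \<and> (c \<in> e \<longleftrightarrow> d \<notin> e)" for e
    unfolding clique_def Un_iff Diff_iff mem_Collect_eq sub by argo
  then have "?L = {e \<in> edges n. ?Q e \<and> (a \<in> e \<longleftrightarrow> b \<notin> e) \<and> (c \<in> e \<longleftrightarrow> d \<notin> e)}"
    unfolding set_eq_iff mem_Collect_eq by (rule allI)
  also have "\<dots> = ?R"
  proof (intro equalityI subsetI)
    fix e
    assume "e \<in> {e \<in> edges n. ?Q e \<and> (a \<in> e \<longleftrightarrow> b \<notin> e) \<and> (c \<in> e \<longleftrightarrow> d \<notin> e)}"
    then obtain s t where "e \<in> edges n" "s \<in> {a, b}" "t \<in> {c, d}" "s \<in> e" "t \<in> e"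
      by blast
    moreover from this have "s \<noteq> t" using assms(2) by auto
    ultimately have "e = {s, t}" using edge_eq_doubleton by blast
    then show "e \<in> ?R"
      using \<open>s \<in> {a, b}\<close> \<open>t \<in> {c, d}\<close> by (auto simp: four_cycle_def)
  next
    fix e assume "e \<in> ?R"
    then show "e \<in> {e \<in> edges n. ?Q e \<and> (a \<in> e \<longleftrightarrow> b \<notin> e) \<and> (c \<in> e \<longleftrightarrow> d \<notin> e)}"
      using assms unfolding four_cycle_def edges_eq by (elim insertE) auto
  qed
  finally show ?thesis .
qed

text \<open>The two triangles share only the edge \<open>{r, j}\<close>, which cancels and becomes a
  diagonal of the cycle.\<close>

lemma triangle_sum_four_cycle:
  assumes "{r, i, j, l} \<subseteq> {1..n}" "distinct [r, i, j, l]"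
  shows "sym_diff (clique n {r, i, j}) (clique n {r, j, l}) = four_cycle r i j l"
    (is "?L = ?R")
proof (intro equalityI subsetI)
  fix e
  assume e: "e \<in> ?L"
  then obtain x y where xy: "e = {x, y}" "x \<noteq> y"
    by (auto simp: clique_def edges_def)
  have "\<not> e \<subseteq> {r, j}" "e \<subseteq> {r, i, j} \<or> e \<subseteq> {r, j, l}"
    using e by (auto simp: clique_def)
  then show "e \<in> ?R"
    using xy unfolding four_cycle_def by auto
next
  fix e assume "e \<in> ?R"
  then show "e \<in> ?L"
    using assms unfolding four_cycle_def clique_def edges_eq by (elim insertE) auto
qed

section \<open>Edge sets modulo 4-cycles\<close>

text \<open>Isolates what the generation argument uses about the supports of \<open>H_k\<close>.
  Every edge set is its own inverse, so the first two assumptions describe a subgroup, and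
  \<open>sym_diff F G \<in> H\<close> expresses congruence of \<open>F\<close> and \<open>G\<close>
  modulo \<open>H\<close>.\<close>

locale four_cycle_space =
  fixes n :: nat and H :: "nat set set set"
  assumes empty_mem: "{} \<in> H"
    and sym_diff_mem: "F \<in> H \<Longrightarrow> G \<in> H \<Longrightarrow> sym_diff F G \<in> H"
    and four_cycle_mem:
      "{a, b, c, d} \<subseteq> {1..n} \<Longrightarrow> distinct [a, b, c, d] \<Longrightarrow> four_cycle a b c d \<in> H"
begin

lemma mem_sym_diff_cancel:
  assumes "sym_diff F G \<in> H" "G \<in> H"
  shows "F \<in> H"
proof -
  have "sym_diff (sym_diff F G) G = F" by auto
  then show ?thesis using sym_diff_mem[OF assms] by simp
qed

lemma sym_diff_trans:
  assumes "sym_diff F G \<in> H" "sym_diff G K \<in> H"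
  shows "sym_diff F K \<in> H"
proof -
  have "sym_diff (sym_diff F G) (sym_diff G K) = sym_diff F K" by auto
  then show ?thesis using sym_diff_mem[OF assms] by simp
qed

text \<open>For \<open>e = {i, j}\<close> and \<open>f = {l, m}\<close> the passage goes through the
  edge \<open>{j, l}\<close>: triangles at \<open>r\<close> over edges that share a vertex are equal
  or differ by a 4-cycle. If \<open>j = l\<close>, a single such move suffices.\<close>

lemma triangles_congruent:
  assumes "r \<in> {1..n}" "e \<in> edges n" "f \<in> edges n" "r \<notin> e" "r \<notin> f"
  shows "sym_diff (clique n (insert r e)) (clique n (insert r f)) \<in> H"
proof -
  have step: "sym_diff (clique n {r, i, j}) (clique n {r, j, l}) \<in> H"
    if "{i, j, l} \<subseteq> {1..n}" "r \<notin> {i, j, l}" "i \<noteq> j" "j \<noteq> l" for i j l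
  proof (cases "i = l")
    case True
    then have "{r, i, j} = {r, j, l}" by auto
    then show ?thesis using empty_mem by simp
  next
    case False
    then show ?thesis
      using that assms(1) triangle_sum_four_cycle[of r i j l n] four_cycle_mem[of r i j l] by auto
  qed
  obtain i j where e: "e = {i, j}" "i \<noteq> j" "i \<in> {1..n}" "j \<in> {1..n}"
    using assms(2) by (auto simp: edges_def)
  obtain l m where f: "f = {l, m}" "l \<noteq> m" "l \<in> {1..n}" "m \<in> {1..n}"
    using assms(3) by (auto simp: edges_def)
  show ?thesis
  proof (cases "j = l")
    case True
    then show ?thesis using step[of i j m] assms e f by auto
  next
    case False
    have "sym_diff (clique n {r, i, j}) (clique n {r, j, l}) \<in> H"
      using step[of i j l] assms e f False by auto
    moreover have "sym_diff (clique n {r, j, l}) (clique n {r, l, m}) \<in> H"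
      using step[of j l m] assms e f False by auto
    ultimately show ?thesis unfolding e(1) f(1) by (rule sym_diff_trans)
  qed
qed

text \<open>The triangle on \<open>{r} \<union> e\<^sub>0\<close> represents the only possible nontrivial class of an even graph.\<close>

lemma even_graph_cases:
  assumes "r \<in> {1..n}" "e\<^sub>0 \<in> edges n" "r \<notin> e\<^sub>0"
    and "F \<subseteq> edges n" "odd_vertices n F = {}"
  shows "if even (card F) then F \<in> H else sym_diff F (clique n (insert r e\<^sub>0)) \<in> H"
  using assms(4,5)
proof (induction "card {e \<in> F. r \<notin> e}" arbitrary: F)
  case 0
  have fin: "finite F" using 0(2) finite_edges by (rule finite_subset)
  have r: "r \<in> e" if "e \<in> F" for e using 0(1) fin that by auto
  \<comment> \<open>All edges contain \<open>r\<close>, so \<open>F\<close> is a star, and a leaf of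
    a nonempty star would have degree 1.\<close>
  have "F = {}"
  proof (rule ccontr)
    assume "F \<noteq> {}"
    then obtain e where e: "e \<in> F" by auto
    then obtain x where x: "e = {r, x}" "x \<in> {1..n}" "x \<noteq> r"
      using r[OF e] 0(2) by (auto simp: edges_def)
    have "f = e" if "f \<in> F" "x \<in> f" for f
      using r[OF that(1)] that 0(2) x by (auto simp: edges_def)
    moreover have "x \<in> e" using x(1) by simp
    ultimately have "{f \<in> F. x \<in> f} = {e}" using e by blast
    then have "deg F x = 1" by (simp add: deg_def)
    then show False using 0(3) x by (auto simp: odd_vertices_def)
  qed
  then show ?case using empty_mem by simp
next
  case (Suc t)
  have fin: "finite F" using Suc.prems(1) finite_edges by (rule finite_subset)
  have "{e \<in> F. r \<notin> e} \<noteq> {}" using Suc.hyps(2) by (metis card.empty nat.distinct(1))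
  then obtain e where e: "e \<in> F" "r \<notin> e" by auto
  then have eE: "e \<in> edges n" using Suc.prems by auto
  \<comment> \<open>In this triangle \<open>e\<close> is the only edge avoiding \<open>r\<close>, so
    adding \<open>T\<close> to \<open>F\<close> removes \<open>e\<close> from the set counted by the
    induction. Having three edges, \<open>T\<close> also flips the parity of
    \<open>card F\<close>.\<close>
  define T where "T = clique n (insert r e)"
  define T\<^sub>0 where "T\<^sub>0 = clique n (insert r e\<^sub>0)"
  have X: "insert r e \<subseteq> {1..n}" "card (insert r e) = 3"
    using eE e(2) assms(1) by (auto simp: edges_eq card_insert_if card_ge_0_finite)
  have T: "T \<subseteq> edges n" "finite T" "odd (card T)" "odd_vertices n T = {}"
    using X by (simp_all add: T_def clique_subset_edges card_clique odd_vertices_clique even_choose_two)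
  have "e \<in> T" using eE unfolding T_def clique_def by blast
  moreover have "f = e" if "f \<in> T" "r \<notin> f" for f
  proof -
    have "f \<subseteq> e" "card f = card e" "finite e"
      using that eE unfolding T_def by (auto simp: clique_def edges_eq card_ge_0_finite)
    then show ?thesis using card_subset_eq by blast
  qed
  ultimately have "{f \<in> T. r \<notin> f} = {e}"
    using e(2) by blast
  moreover have "{f \<in> sym_diff F T. r \<notin> f} = sym_diff {f \<in> F. r \<notin> f} {f \<in> T. r \<notin> f}"
    by auto
  ultimately have "{f \<in> sym_diff F T. r \<notin> f} = {f \<in> F. r \<notin> f} - {e}"
    using e by (simp add: insert_absorb)
  then have t: "t = card {f \<in> sym_diff F T. r \<notin> f}"
    using Suc.hyps(2) e fin by simp
  have IH: "if even (card (sym_diff F T)) then sym_diff F T \<in> H else sym_diff (sym_diff F T) T\<^sub>0 \<in> H"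
    unfolding T\<^sub>0_def using Suc.hyps(1)[OF t] Suc.prems T fin
    by (simp add: odd_vertices_sym_diff Un_subset_iff subset_trans[OF Diff_subset])
  have par: "even (card (sym_diff F T)) \<longleftrightarrow> odd (card F)"
    using T fin by (simp add: even_card_sym_diff)
  have TT: "sym_diff T T\<^sub>0 \<in> H"
    unfolding T_def T\<^sub>0_def using triangles_congruent assms eE e by auto
  \<comment> \<open>Since \<open>T\<close> flips the parity, the two cases of the induction
    hypothesis are exchanged; \<open>TT\<close> trades \<open>T\<close> for
    \<open>T\<^sub>0\<close>.\<close>
  show ?case
  proof (cases "even (card F)")
    case True
    then have "sym_diff (sym_diff F T) T\<^sub>0 \<in> H" using IH par by simp
    moreover have "sym_diff (sym_diff F T) T\<^sub>0 = sym_diff F (sym_diff T T\<^sub>0)" by auto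
    ultimately have "sym_diff F (sym_diff T T\<^sub>0) \<in> H" by simp
    then have "F \<in> H" using TT by (rule mem_sym_diff_cancel)
    then show ?thesis using True by simp
  next
    case False
    then have "sym_diff F T \<in> H" using IH par by simp
    then have "sym_diff F T\<^sub>0 \<in> H" using TT by (rule sym_diff_trans)
    then show ?thesis using False T\<^sub>0_def by simp
  qed
qed

lemma even_graph_mem:
  assumes "n \<ge> 3" "F \<subseteq> edges n" "odd_vertices n F = {}" "even (card F)"
  shows "F \<in> H"
proof -
  \<comment> \<open>The reference triangle is the one on the vertices 1, 2, 3, with root 1.\<close>
  have "{2, 3} \<in> edges n" using assms(1) by (auto simp: edges_eq)
  then show ?thesis
    using even_graph_cases[of 1 "{2, 3}" F] assms by auto
qed

text \<open>The sets \<open>P\<close> from \<open>link\<close> behave like paths of even length from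
  \<open>a\<close> to \<open>b\<close>: adding one clears two odd vertices and keeps the edge
  parity. Induction on the number of odd vertices ends at an even graph.\<close>

lemma even_card_mem:
  assumes "n \<ge> 3"
    and link: "\<And>a b. a \<in> {1..n} \<Longrightarrow> b \<in> {1..n} \<Longrightarrow> a \<noteq> b \<Longrightarrow>
      \<exists>P \<in> H. P \<subseteq> edges n \<and> odd_vertices n P = {a, b} \<and> even (card P)"
    and "F \<subseteq> edges n" "even (card F)"
  shows "F \<in> H"
  using assms(3,4)
proof (induction "card (odd_vertices n F)" arbitrary: F rule: less_induct)
  case less
  have fin: "finite F" using less.prems(1) finite_edges by (rule finite_subset)
  show ?case
  proof (cases "odd_vertices n F = {}")
    case True
    then show ?thesis using even_graph_mem less.prems assms(1) by blast
  next
    case False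
    then obtain a where a: "a \<in> odd_vertices n F" by auto
    have "odd_vertices n F \<noteq> {a}" using handshake[OF less.prems(1)] by auto
    then obtain b where b: "b \<in> odd_vertices n F" "a \<noteq> b" using a by auto
    obtain P where P: "P \<in> H" "P \<subseteq> edges n" "odd_vertices n P = {a, b}" "even (card P)"
      using link[of a b] a b by (auto simp: odd_vertices_def)
    have finP: "finite P" using P(2) finite_edges by (rule finite_subset)
    have "odd_vertices n (sym_diff F P) = odd_vertices n F - {a, b}"
      using a b fin finP by (auto simp: odd_vertices_sym_diff P)
    also have "\<dots> \<subset> odd_vertices n F" using a by auto
    finally have "card (odd_vertices n (sym_diff F P)) < card (odd_vertices n F)"
      by (simp add: psubset_card_mono)
    moreover have "even (card (sym_diff F P))"
      using fin finP P less.prems by (simp add: even_card_sym_diff)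
    moreover have "sym_diff F P \<subseteq> edges n" using P less.prems by auto
    ultimately have "sym_diff F P \<in> H" using less.hyps by blast
    then show ?thesis using mem_sym_diff_cancel P(1) by blast
  qed
qed

end

section \<open>Passing between vectors and their supports\<close>

lemma support_subset_edges: "support n f \<subseteq> edges n"
  by (auto simp: support_def)

lemma finite_support [simp]: "finite (support n f)"
  using support_subset_edges finite_edges by (rule finite_subset)

lemma support_clique_vector: "support n (clique_vector n X) = clique n X"
  by (auto simp: support_def clique_vector_def clique_def)

lemma support_one: "support n \<one>\<^bsub>edge_space n\<^esub> = {}"
  by (auto simp: support_def)

lemma edge_space_apply:
  assumes "f \<in> carrier (edge_space n)" "e \<in> edges n"
  shows "f e = 0 \<or> f e = 1"
proof -
  have "f e \<in> {0..<2}"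
    using assms by (auto simp: carrier_integer_mod_group)
  then show ?thesis by auto
qed

lemma support_mult:
  assumes "f \<in> carrier (edge_space n)" "g \<in> carrier (edge_space n)"
  shows "support n (f \<otimes>\<^bsub>edge_space n\<^esub> g) = sym_diff (support n f) (support n g)"
  using edge_space_apply[OF assms(1)] edge_space_apply[OF assms(2)]
  by (fastforce simp: support_def)

text \<open>Entries on \<open>edges n\<close> are 0 or 1 and vectors are extensional elsewhere, so
  the positions of the ones determine the vector.\<close>

lemma inj_on_support: "inj_on (support n) (carrier (edge_space n))"
proof (rule inj_onI)
  fix f g
  assume f: "f \<in> carrier (edge_space n)" and g: "g \<in> carrier (edge_space n)"
    and eq: "support n f = support n g"
  show "f = g"
  proof (rule PiE_ext)
    show "f \<in> (\<Pi>\<^sub>E i\<in>edges n. carrier F2)" "g \<in> (\<Pi>\<^sub>E i\<in>edges n. carrier F2)"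
      using f g by simp_all
    fix e assume e: "e \<in> edges n"
    then have "f e = 1 \<longleftrightarrow> g e = 1" using eq by (auto simp: support_def)
    then show "f e = g e"
      using edge_space_apply[OF f e] edge_space_apply[OF g e] by auto
  qed
qed

lemma group_edge_space: "group (edge_space n)"
  by simp

lemma inv_edge_space:
  assumes "f \<in> carrier (edge_space n)"
  shows "inv\<^bsub>edge_space n\<^esub> f = f"
proof -
  interpret group "edge_space n" by (rule group_edge_space)
  have "support n (f \<otimes>\<^bsub>edge_space n\<^esub> f) = support n \<one>\<^bsub>edge_space n\<^esub>"
    using support_mult[OF assms assms] by (simp only: support_one) auto
  then have "f \<otimes>\<^bsub>edge_space n\<^esub> f = \<one>\<^bsub>edge_space n\<^esub>"
    using inj_on_support m_closed[OF assms assms] one_closed by (meson inj_onD)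
  then show ?thesis using inv_equality assms by blast
qed

lemma clique_subgroup_carrier: "clique_subgroup n k \<subseteq> carrier (edge_space n)"
proof -
  interpret group "edge_space n" by (rule group_edge_space)
  show ?thesis
    unfolding clique_subgroup_def using clique_vector_carrier by (intro generate_incl) blast
qed

text \<open>Induction over \<open>generate\<close>, carried to edge sets. Inverses give no separate
  case because each vector is its own inverse; the inclusions in \<open>edges n\<close> supply
  finiteness for the parity lemmas.\<close>

lemma clique_subgroup_support_induct:
  assumes "f \<in> clique_subgroup n k" "P {}"
    and "\<And>X. X \<subseteq> {1..n} \<Longrightarrow> card X = k \<Longrightarrow> P (clique n X)"
    and "\<And>F G. F \<subseteq> edges n \<Longrightarrow> G \<subseteq> edges n \<Longrightarrow> P F \<Longrightarrow> P G \<Longrightarrow> P (sym_diff F G)"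
  shows "P (support n f)"
  using assms(1) unfolding clique_subgroup_def
proof (induction rule: generate.induct)
  case one
  then show ?case by (simp only: support_one assms(2))
next
  case (incl h)
  then show ?case using assms(3) by (auto simp: support_clique_vector)
next
  case (inv h)
  then obtain X where X: "h = clique_vector n X" "X \<subseteq> {1..n}" "card X = k" by auto
  then show ?case
    using assms(3) by (simp only: inv_edge_space[OF clique_vector_carrier] support_clique_vector)
next
  case (eng f g)
  then have "f \<in> carrier (edge_space n)" "g \<in> carrier (edge_space n)"
    using clique_subgroup_carrier unfolding clique_subgroup_def by blast+
  then show ?case
    using eng.IH assms(4) support_subset_edges by (simp only: support_mult)
qed

lemma edge_parity_kernel:
  "kernel (edge_space n) F2 (edge_parity n) = {f \<in> carrier (edge_space n). even (card (support n f))}"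
  by (auto simp: kernel_def edge_parity_def)

lemma degree_parity_kernel:
  "kernel (edge_space n) (F2_power {1..n}) (degree_parity n) =
     {f \<in> carrier (edge_space n). odd_vertices n (support n f) = {}}"
proof -
  have "degree_parity n f = (\<lambda>v\<in>{1..n}. 0) \<longleftrightarrow> odd_vertices n (support n f) = {}" for f
    by (auto simp: degree_parity_def odd_vertices_def fun_eq_iff restrict_def)
  then show ?thesis
    by (simp add: kernel_def)
qed

lemma clique_mem_support_image:
  assumes "X \<subseteq> {1..n}" "card X = k"
  shows "clique n X \<in> support n ` clique_subgroup n k"
proof -
  have "clique_vector n X \<in> clique_subgroup n k"
    unfolding clique_subgroup_def using assms by (intro generate.incl) blast
  then show ?thesis by (metis imageI support_clique_vector)
qed

lemma mem_clique_subgroupI: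
  assumes "f \<in> carrier (edge_space n)" "support n f \<in> support n ` clique_subgroup n k"
  shows "f \<in> clique_subgroup n k"
  using assms inj_on_support clique_subgroup_carrier by (meson inj_on_image_mem_iff)

text \<open>The common frame for all residues of \<open>k\<close>: the first premise says that
  \<open>P\<close> is an invariant of the subgroup, the second that the cliques generate everything
  satisfying \<open>P\<close>.\<close>

lemma clique_subgroup_eqI:
  assumes "\<And>f. f \<in> clique_subgroup n k \<Longrightarrow> P (support n f)"
    and "\<And>F. F \<subseteq> edges n \<Longrightarrow> P F \<Longrightarrow> F \<in> support n ` clique_subgroup n k"
  shows "clique_subgroup n k = {f \<in> carrier (edge_space n). P (support n f)}"
proof (intro equalityI subsetI CollectI conjI)
  fix f assume "f \<in> {f \<in> carrier (edge_space n). P (support n f)}"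
  then have f: "f \<in> carrier (edge_space n)" "P (support n f)" by (rule CollectE, blast)+
  show "f \<in> clique_subgroup n k"
    using f(1) assms(2)[OF support_subset_edges f(2)] by (rule mem_clique_subgroupI)
next
  fix f assume f: "f \<in> clique_subgroup n k"
  then show "f \<in> carrier (edge_space n)" using clique_subgroup_carrier by (rule rev_subsetD)
  show "P (support n f)" using f by (rule assms(1))
qed

lemma sym_diff_support_image:
  assumes "F \<in> support n ` clique_subgroup n k" "G \<in> support n ` clique_subgroup n k"
  shows "sym_diff F G \<in> support n ` clique_subgroup n k"
proof -
  obtain f g where fg: "f \<in> clique_subgroup n k" "g \<in> clique_subgroup n k"
    "F = support n f" "G = support n g"
    using assms by auto
  have "f \<otimes>\<^bsub>edge_space n\<^esub> g \<in> clique_subgroup n k"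
    using fg(1,2) unfolding clique_subgroup_def by (rule generate.eng)
  moreover have "support n (f \<otimes>\<^bsub>edge_space n\<^esub> g) = sym_diff F G"
    unfolding fg(3,4) by (intro support_mult fg(1,2)[THEN subsetD[OF clique_subgroup_carrier]])
  ultimately show ?thesis by (intro image_eqI) (rule sym)
qed

section \<open>4-cycles and links inside the clique subgroup\<close>

lemma obtain_disjoint_subset:
  fixes n :: nat
  assumes "A \<subseteq> {1..n}" "m + card A \<le> n"
  obtains Z where "Z \<subseteq> {1..n}" "Z \<inter> A = {}" "card Z = m" "finite Z"
proof -
  have "finite A" using assms(1) finite_subset by blast
  then have "m \<le> card ({1..n} - A)"
    using assms by (simp add: card_Diff_subset)
  then obtain Z where "Z \<subseteq> {1..n} - A" "card Z = m" "finite Z"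
    by (rule obtain_subset_with_card_n)
  then show ?thesis using that by blast
qed

lemma four_cycle_space_clique_subgroup:
  assumes "2 \<le> k" "k + 2 \<le> n"
  shows "four_cycle_space n (support n ` clique_subgroup n k)"
proof
  show "{} \<in> support n ` clique_subgroup n k"
  proof -
    have "\<one>\<^bsub>edge_space n\<^esub> \<in> clique_subgroup n k"
      unfolding clique_subgroup_def by (rule generate.one)
    then show ?thesis by (metis imageI support_one)
  qed
next
  fix F G
  assume "F \<in> support n ` clique_subgroup n k" "G \<in> support n ` clique_subgroup n k"
  then show "sym_diff F G \<in> support n ` clique_subgroup n k"
    by (rule sym_diff_support_image)
next
  fix a b c d
  assume abcd: "{a, b, c, d} \<subseteq> {1..n}" "distinct [a, b, c, d]"
  have "card {a, b, c, d} = 4" using abcd(2) by simp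
  \<comment> \<open>With \<open>2 \<le> k\<close> the left side equals \<open>k + 2\<close>, so the
    room for \<open>Z\<close> is exactly the bound on \<open>k\<close>.\<close>
  then have "k - 2 + card {a, b, c, d} \<le> n" using assms by linarith
  then obtain Z where Z: "Z \<subseteq> {1..n}" "Z \<inter> {a, b, c, d} = {}" "card Z = k - 2" "finite Z"
    by (rule obtain_disjoint_subset[OF abcd(1)])
  have mem: "clique n (Z \<union> {s, t}) \<in> support n ` clique_subgroup n k"
    if "s \<in> {a, c}" "t \<in> {b, d}" for s t
  proof (rule clique_mem_support_image)
    show "Z \<union> {s, t} \<subseteq> {1..n}" using Z abcd that by auto
    have "s \<notin> Z" "t \<notin> Z" "s \<noteq> t" using Z abcd that by auto
    then show "card (Z \<union> {s, t}) = k" using Z assms by simp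
  qed
  have "sym_diff (sym_diff (clique n (Z \<union> {a, b})) (clique n (Z \<union> {c, b})))
      (sym_diff (clique n (Z \<union> {a, d})) (clique n (Z \<union> {c, d})))
      \<in> support n ` clique_subgroup n k"
    by (intro sym_diff_support_image mem) auto
  moreover have "sym_diff (sym_diff (clique n (Z \<union> {a, b})) (clique n (Z \<union> {c, b})))
      (sym_diff (clique n (Z \<union> {a, d})) (clique n (Z \<union> {c, d}))) = four_cycle a b c d"
    using abcd Z by (intro clique_sum_four_cycle) auto
  ultimately show "four_cycle a b c d \<in> support n ` clique_subgroup n k" by simp
qed

text \<open>For even \<open>k\<close> the odd vertices of a \<open>k\<close>-clique are all its
  points, so those in the common part \<open>Y\<close> cancel. The two cliques have equally many
  edges, so their sum has an even number.\<close>

lemma link_mem_support_image: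
  assumes "even k" "2 \<le> k" "k + 1 \<le> n" "a \<in> {1..n}" "b \<in> {1..n}" "a \<noteq> b"
  shows "\<exists>P \<in> support n ` clique_subgroup n k.
    P \<subseteq> edges n \<and> odd_vertices n P = {a, b} \<and> even (card P)"
proof -
  obtain Y where Y: "Y \<subseteq> {1..n}" "Y \<inter> {a, b} = {}" "card Y = k - 1" "finite Y"
    using obtain_disjoint_subset[of "{a, b}" n "k - 1"] assms by auto
  have X: "insert a Y \<subseteq> {1..n}" "card (insert a Y) = k" "insert b Y \<subseteq> {1..n}" "card (insert b Y) = k"
    using Y assms by auto
  let ?P = "sym_diff (clique n (insert a Y)) (clique n (insert b Y))"
  have "?P \<in> support n ` clique_subgroup n k"
    using X by (intro sym_diff_support_image clique_mem_support_image)
  moreover have "odd_vertices n ?P = {a, b}"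
    using X Y assms by (auto simp: odd_vertices_sym_diff odd_vertices_clique)
  moreover have "even (card ?P)"
    using X by (simp add: even_card_sym_diff card_clique)
  moreover have "?P \<subseteq> edges n"
    using clique_subset_edges by blast
  ultimately show ?thesis by blast
qed

section \<open>The four residue classes of \<open>k\<close> modulo 4\<close>

theorem theorem1p4:
  fixes n k :: nat
  assumes "n \<ge> 4" and "2 \<le> k" and "k \<le> n - 2"
  shows "(k mod 4 = 2 \<longrightarrow>
            clique_subgroup n k = carrier (edge_space n)) \<and>
         (k mod 4 = 0 \<longrightarrow>
            clique_subgroup n k = kernel (edge_space n) F2 (edge_parity n)) \<and>
         (k mod 4 = 3 \<longrightarrow>
            clique_subgroup n k = kernel (edge_space n) (F2_power {1..n}) (degree_parity n)) \<and>
         (k mod 4 = 1 \<longrightarrow>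
            clique_subgroup n k =
              kernel (edge_space n) (F2_power {1..n}) (degree_parity n) \<inter>
              kernel (edge_space n) F2 (edge_parity n))"
proof -
  let ?H = "support n ` clique_subgroup n k"
  have kn: "k + 2 \<le> n" "n \<ge> 3" using assms by auto
  interpret four_cycle_space n ?H
    using assms(2) kn(1) by (rule four_cycle_space_clique_subgroup)
  have fin: "finite F" if "F \<subseteq> edges n" for F
    using that finite_edges by (rule finite_subset)
  \<comment> \<open>The inclusions of \<open>H_k\<close> in the kernels: both parities vanish on the
    generating cliques for the stated \<open>k\<close> and are additive.\<close>
  have even_card: "even (card (support n f))"
    if "f \<in> clique_subgroup n k" "k mod 4 = 0 \<or> k mod 4 = 1" for f
    using that(1)
  proof (rule clique_subgroup_support_induct)
    show "even (card (clique n X))" if "X \<subseteq> {1..n}" "card X = k" for X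
      using that \<open>k mod 4 = 0 \<or> k mod 4 = 1\<close> by (simp add: card_clique even_choose_two)
  qed (simp_all add: even_card_sym_diff fin)
  have even_deg: "odd_vertices n (support n f) = {}"
    if "f \<in> clique_subgroup n k" "odd k" for f
    using that(1)
  proof (rule clique_subgroup_support_induct)
    show "odd_vertices n (clique n X) = {}" if "X \<subseteq> {1..n}" "card X = k" for X
      using that \<open>odd k\<close> by (simp add: odd_vertices_clique)
  qed (simp_all add: odd_vertices_sym_diff fin)
  obtain X where X: "X \<subseteq> {1..n}" "card X = k"
    using obtain_disjoint_subset[of "{}" n k] kn by auto
  have KH: "clique n X \<in> ?H" using X by (rule clique_mem_support_image)
  have even_mem: "F \<in> ?H" if "even k" "F \<subseteq> edges n" "even (card F)" for F
    using kn that assms(2) by (intro even_card_mem link_mem_support_image) auto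
  \<comment> \<open>For these residues a \<open>k\<close>-clique has an odd number of edges, so
    adding one fixed clique reduces an odd \<open>F\<close> to the even case; for odd
    \<open>k\<close> it leaves all degree parities unchanged.\<close>
  have shift: "F \<in> ?H" if "F \<subseteq> edges n" "odd (card F)" "k mod 4 = 2 \<or> k mod 4 = 3"
    "odd k \<Longrightarrow> odd_vertices n F = {}" for F
  proof -
    let ?G = "sym_diff F (clique n X)"
    have "even (card ?G)"
      using that X by (auto simp: even_card_sym_diff card_clique even_choose_two fin)
    moreover have "?G \<subseteq> edges n" using that(1) clique_subset_edges by blast
    moreover have "odd_vertices n ?G = {}" if "odd k"
      using that \<open>odd k \<Longrightarrow> odd_vertices n F = {}\<close> X \<open>F \<subseteq> edges n\<close>
      by (simp add: odd_vertices_sym_diff odd_vertices_clique fin)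
    ultimately have "?G \<in> ?H"
      using even_mem even_graph_mem kn by blast
    then show ?thesis using mem_sym_diff_cancel KH by blast
  qed
  have "clique_subgroup n k = carrier (edge_space n)" if k: "k mod 4 = 2"
  proof -
    have "even k" using k by presburger
    then have "F \<in> ?H" if "F \<subseteq> edges n" for F
      using that k by (cases "even (card F)") (auto intro: even_mem shift)
    \<comment> \<open>The trivial predicate puts the full carrier into the shape of
      \<open>clique_subgroup_eqI\<close>.\<close>
    then have "clique_subgroup n k = {f \<in> carrier (edge_space n). True}"
      by (intro clique_subgroup_eqI[where P = "\<lambda>_. True"]) auto
    then show ?thesis by (simp only: simp_thms Collect_mem_eq)
  qed
  moreover have "clique_subgroup n k = kernel (edge_space n) F2 (edge_parity n)" if k: "k mod 4 = 0"
  proof -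
    have "even k" using k by presburger
    then show ?thesis
      unfolding edge_parity_kernel using k
      by (intro clique_subgroup_eqI[where P = "\<lambda>F. even (card F)"] even_mem even_card) auto
  qed
  moreover have "clique_subgroup n k = kernel (edge_space n) (F2_power {1..n}) (degree_parity n)"
    if k: "k mod 4 = 3"
  proof -
    have "odd k" using k by presburger
    moreover have "F \<in> ?H" if "F \<subseteq> edges n" "odd_vertices n F = {}" for F
      using that k kn(2) by (cases "even (card F)") (auto intro: even_graph_mem shift)
    ultimately show ?thesis
      unfolding degree_parity_kernel
      by (intro clique_subgroup_eqI[where P = "\<lambda>F. odd_vertices n F = {}"] even_deg) auto
  qed
  moreover have "clique_subgroup n k =
      kernel (edge_space n) (F2_power {1..n}) (degree_parity n) \<inter>
      kernel (edge_space n) F2 (edge_parity n)" if k: "k mod 4 = 1"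
  proof -
    have "odd k" using k by presburger
    then have "clique_subgroup n k = {f \<in> carrier (edge_space n).
        odd_vertices n (support n f) = {} \<and> even (card (support n f))}"
      using k kn(2)
      by (intro clique_subgroup_eqI[where P = "\<lambda>F. odd_vertices n F = {} \<and> even (card F)"]
          conjI even_deg even_card even_graph_mem) auto
    then show ?thesis
      unfolding degree_parity_kernel edge_parity_kernel by blast
  qed
  ultimately show ?thesis by blast
qed

end
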